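(* Let $\{G_n\}$ be a sequence of finite simple graphs with bounded average degree such that $$\lim_{n\to\infty}|V(G_n)|=\infty\quad\text{and}\quad \lim_{n\to\infty}\frac{LEL(G_n)}{|V(G_n)|}=h\neq 0 .$$ Let $\{H_n\}$ be a sequence of graphs with $H_n$ a spanning subgraph of $G_n$ for each $n$, such that $$\lim_{n\to\infty}\frac{|\{v\in V(H_n): d_{H_n}(v)=d_{G_n}(v)\}|}{|V(G_n)|}=1 .$$ Then $$\lim_{n\to\infty}\frac{LEL(H_n)}{|V(G_n)|}=h,$$ i.e. $G_n$ and $H_n$ have the same asymptotic Laplacian-energy-like invariant.
   Context: For a finite simple graph $G$ on $N$ vertices with Laplacian matrix $L(G)=D(G)-A(G)$ and Laplacian eigenvalues $\mu_1\ge\cdots\ge\mu_N$, $LEL(G)=\sum_{i=1}^{N-1}\sqrt{\mu_i}$. $d_G(v)$ denotes the degree of $v$ in $G$. A sequence $\{G_n\}$ has bounded average degree if $\sup_n 2|E(G_n)|/|V(G_n)|<\infty$. *)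

theory Defs
  imports
    "Graph_Theory.Graph_Theory"
    "Jordan_Normal_Form.Char_Poly"
begin

text \<open>
  A finite simple graph is a \<open>pair_graph\<close>: finite vertex set, symmetric and irreflexive
  arc relation.  Every undirected edge is thus represented by its two opposite arcs, and the
  out-degree of a vertex is its number of neighbours.
\<close>

definition edge_set :: "'a pair_pre_digraph \<Rightarrow> 'a set set" where
  "edge_set G = {{u, v} | u v. (u, v) \<in> parcs G}"

definition degree_mat :: "'a pair_pre_digraph \<Rightarrow> 'a list \<Rightarrow> real mat" where
  "degree_mat G vs = mat (length vs) (length vs)
     (\<lambda>(i, j). if i = j then real (out_degree (with_proj G) (vs ! i)) else 0)"

definition adjacency_mat :: "'a pair_pre_digraph \<Rightarrow> 'a list \<Rightarrow> real mat" where
  "adjacency_mat G vs = mat (length vs) (length vs)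
     (\<lambda>(i, j). if (vs ! i, vs ! j) \<in> parcs G then 1 else 0)"

definition vertex_list :: "'a pair_pre_digraph \<Rightarrow> 'a list" where
  "vertex_list G = (SOME vs. distinct vs \<and> set vs = pverts G)"

text \<open>
  The matrix depends on the enumeration of the vertices chosen by \<open>vertex_list\<close>, but a different
  enumeration only conjugates it by a permutation matrix, so its eigenvalues do not.
\<close>

definition laplacian_mat :: "'a pair_pre_digraph \<Rightarrow> real mat" where
  "laplacian_mat G = degree_mat G (vertex_list G) - adjacency_mat G (vertex_list G)"

text \<open>
  Eigenvalues with multiplicity in non-increasing order.  The Laplacian is a real symmetric matrix,
  so all roots of its characteristic polynomial are real and the list has one entry per vertex.
  Lists are indexed from 0: \<open>laplacian_eigenvalues G ! i\<close> is $\mu_{i+1}$.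
\<close>

definition laplacian_eigenvalues :: "'a pair_pre_digraph \<Rightarrow> real list" where
  "laplacian_eigenvalues G =
     rev (sorted_list_of_multiset (proots (char_poly (laplacian_mat G))))"

definition LEL :: "'a pair_pre_digraph \<Rightarrow> real" where
  "LEL G = (\<Sum>i < card (pverts G) - 1. sqrt (laplacian_eigenvalues G ! i))"

definition bounded_average_degree :: "(nat \<Rightarrow> 'a pair_pre_digraph) \<Rightarrow> bool" where
  "bounded_average_degree G \<longleftrightarrow>
     bdd_above (range (\<lambda>n. 2 * real (card (edge_set (G n))) / real (card (pverts (G n)))))"

end

theory Submission
  imports Defs "HOL-Analysis.Convex"
begin

text \<open>
  Write $L_G = L_H + P$, where $P$ is the Laplacian of the deleted edges.  For an orthonormal
  eigenbasis $u_i$ of $L_G$ with eigenvalues $\lambda_i$ put $z_i = u_i / \sqrt{\lambda_i}$, so that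
  $\sum_i \sqrt{\lambda_i} = \sum_i \langle z_i, L_G u_i\rangle$ and the $z_i$ are orthonormal for the
  form of $L_G$.  Expanding $u_i$ in any other orthonormal basis $v_j$ and applying the Cauchy-Schwarz
  inequality for a positive semidefinite form $A \le L_G$ gives
  $\sum_i \langle z_i, A u_i\rangle \le \sum_j \sqrt{\langle v_j, A v_j\rangle}$.

  Taking for $v_j$ an eigenbasis of $L_H$ when $A = L_H$, and the standard basis when $A = P$, yields
  $LEL(G) \le LEL(H) + \sum_v \sqrt{d_G(v) - d_H(v)}$.  Only the vertices whose degree changes
  contribute to the last sum; if there are $b$ of them it is at most $\sqrt{2 b |E(G)|}$, which is
  $o(|V(G)|)$.  Applied instead to $L_H$ alone, with $v_j$ an eigenbasis of $L_G$, the estimate gives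
  $LEL(H) \le \sum_j \sqrt{\langle v_j, L_H v_j\rangle} \le LEL(G)$.
\<close>

unbundle no inner_syntax

section \<open>Orthogonal diagonalization of real symmetric matrices\<close>

text \<open>For $w = 0$ the convention $2/0 = 0$ makes the reflection the identity.\<close>

definition householder :: "real vec \<Rightarrow> real mat" where
  "householder w = mat (dim_vec w) (dim_vec w)
     (\<lambda>(i, j). (if i = j then 1 else 0) - 2 / (w \<bullet> w) * (w $ i * w $ j))"

lemma householder_carrier [simp]: "w \<in> carrier_vec n \<Longrightarrow> householder w \<in> carrier_mat n n"
  by (auto simp: householder_def)

lemma transpose_householder [simp]: "transpose_mat (householder w) = householder w"
  by (rule eq_matI) (auto simp: householder_def mult.commute)

text \<open>With \<open>c = 2 / (w \<bullet> w)\<close> the square of I - c w w^T is I - 2 c w w^T +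
  c^2 (w.w) w w^T, and the last two terms cancel.\<close>

lemma householder_involution:
  assumes "w \<in> carrier_vec n"
  shows "householder w * householder w = 1\<^sub>m n"
proof (rule eq_matI)
  fix i j assume "i < dim_row (1\<^sub>m n)" "j < dim_col (1\<^sub>m n)"
  then have ij: "i < n" "j < n" by auto
  let ?d = "\<lambda>i j :: nat. if i = j then 1 else (0::real)"
  define c where "c = 2 / (w \<bullet> w)"
  have ww: "w \<bullet> w = (\<Sum>k<n. w $ k * w $ k)"
    using assms by (simp add: scalar_prod_def atLeast0LessThan)
  have "(householder w * householder w) $$ (i, j)
      = (\<Sum>k<n. (?d i k - c * (w $ i * w $ k)) * (?d k j - c * (w $ k * w $ j)))"
    using ij assms by (simp add: householder_def scalar_prod_def c_def atLeast0LessThan)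
  also have "\<dots> = (\<Sum>k<n. (if k = i then ?d i j - c * w $ i * w $ j else 0)
       - (if k = j then c * w $ i * w $ j else 0) + c * c * w $ i * w $ j * (w $ k * w $ k))"
    by (rule sum.cong) (auto simp: algebra_simps)
  also have "\<dots> = ?d i j - 2 * c * w $ i * w $ j + c * c * w $ i * w $ j * (w \<bullet> w)"
    using ij by (simp add: sum.distrib sum_subtractf sum_distrib_left ww)
  \<comment> \<open>For nonzero \<open>w\<close> this is \<open>c * (w \<bullet> w) = 2\<close>; for
    \<open>w = 0\<close> both sides vanish.\<close>
  also have "c * c * w $ i * w $ j * (w \<bullet> w) = 2 * c * w $ i * w $ j"
    by (simp add: c_def)
  finally show "(householder w * householder w) $$ (i, j) = 1\<^sub>m n $$ (i, j)"
    using ij by simp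
qed (use assms in \<open>auto simp: householder_def\<close>)

text \<open>The reflection along the difference of two unit vectors exchanges them. It serves to
  move a unit eigenvector into the first coordinate.\<close>

lemma householder_unit_vec:
  assumes v: "v \<in> carrier_vec n" "v \<bullet> v = 1" and n: "0 < n"
  shows "householder (v - unit_vec n 0) *\<^sub>v unit_vec n 0 = v"
proof (rule eq_vecI)
  define w where "w = v - unit_vec n 0"
  have w: "w \<in> carrier_vec n" using v by (simp add: w_def)
  fix i assume "i < dim_vec v"
  then have i: "i < n" using v by simp
  have "w \<bullet> w = v \<bullet> v - v \<bullet> unit_vec n 0 - (unit_vec n 0 \<bullet> v - unit_vec n 0 \<bullet> unit_vec n 0)"
    using v by (simp add: w_def minus_scalar_prod_distrib[of _ n] scalar_prod_minus_distrib[of _ n])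
  also have "\<dots> = - 2 * w $ 0"
    using v n by (simp add: w_def scalar_prod_left_unit scalar_prod_right_unit)
  finally have ww: "w \<bullet> w = - 2 * w $ 0" .
  have "(householder w *\<^sub>v unit_vec n 0) $ i
      = (if i = 0 then 1 else 0) - 2 / (w \<bullet> w) * (w $ i * w $ 0)"
    using i n w by (auto simp: householder_def scalar_prod_right_unit)
  also have "\<dots> = v $ i"
  \<comment> \<open>As \<open>w \<bullet> w = - 2 * w $ 0\<close>, the first case is exactly
    \<open>w = 0\<close>, where \<open>v\<close> already is the first basis vector; in the second
    the quotient cancels.\<close>
  proof (cases "w $ 0 = 0")
    case True
    then have "w = 0\<^sub>v n" using w ww conjugate_square_eq_0_vec[of w n] by simp
    then have "w $ i = 0" using i by simp
    then show ?thesis using True v i n by (auto simp: w_def split: if_splits)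
  next
    case False
    then have "2 / (w \<bullet> w) * (w $ i * w $ 0) = - w $ i" by (simp add: ww)
    then show ?thesis using v i n by (auto simp: w_def)
  qed
  finally show "(householder (v - unit_vec n 0) *\<^sub>v unit_vec n 0) $ i = v $ i"
    by (simp add: w_def)
qed (use v in \<open>simp add: householder_def\<close>)

section \<open>Real eigenvalues and unit eigenvectors of symmetric matrices\<close>

text \<open>Over the complex numbers the characteristic polynomial has a root. The matrix is
  Hermitian there, so the root is real, and it is then a root of the original real
  polynomial.\<close>

lemma symmetric_real_eigenvalue:
  fixes A :: "real mat"
  assumes A: "A \<in> carrier_mat n n" and sym: "transpose_mat A = A" and n: "0 < n"
  shows "\<exists>e. eigenvalue A e"
proof -
  let ?h = "of_real :: real \<Rightarrow> complex"
  define C where "C = map_mat ?h A"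
  have C: "C \<in> carrier_mat n n" using A by (simp add: C_def)
  obtain as where as: "char_poly C = (\<Prod>a\<leftarrow>as. [:- a, 1:])" "length as = n"
    using char_poly_factorized[OF C] by blast
  then obtain a where "a \<in> set as" using n by (cases as) auto
  then have "poly (char_poly C) a = 0" unfolding as(1) by (rule linear_poly_root)
  then have "eigenvalue C a" by (simp add: eigenvalue_root_char_poly[OF C])
  then obtain z where z: "z \<in> carrier_vec n" "z \<noteq> 0\<^sub>v n" "C *\<^sub>v z = a \<cdot>\<^sub>v z"
    using C unfolding eigenvalue_def eigenvector_def by auto
  have symC: "transpose_mat C = C"
    unfolding C_def by (subst sym[symmetric]) (rule eq_matI, auto)
  have conjC: "C *\<^sub>v conjugate z = conjugate (C *\<^sub>v z)"
    using A z(1) by (intro eq_vecI) (auto simp: C_def scalar_prod_def)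
  \<comment> \<open>The Hermitian form of \<open>C\<close> at \<open>z\<close> is evaluated in two
    ways; as \<open>z \<bullet>c z\<close> is nonzero, this forces \<open>a = cnj a\<close>.\<close>
  have "a * (z \<bullet>c z) = (C *\<^sub>v z) \<bullet>c z" using z by simp
  also have "\<dots> = z \<bullet> (C *\<^sub>v conjugate z)"
    using transpose_vec_mult_scalar[OF C, of "conjugate z" z] z symC by simp
  also have "\<dots> = cnj a * (z \<bullet>c z)" using z by (simp add: conjC conjugate_smult_vec)
  finally have "a = cnj a" using z by simp
  then obtain e where e: "a = ?h e" by (metis Reals_cnj_iff Reals_cases)
  have "char_poly C = map_poly ?h (char_poly A)"
    unfolding C_def by (rule of_real_hom.char_poly_hom[OF A])
  with \<open>poly (char_poly C) a = 0\<close> have "poly (char_poly A) e = 0"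
    by (simp add: e)
  then show ?thesis by (auto simp: eigenvalue_root_char_poly[OF A])
qed

lemma symmetric_unit_eigenvector:
  fixes A :: "real mat"
  assumes A: "A \<in> carrier_mat n n" and sym: "transpose_mat A = A" and n: "0 < n"
  obtains v e where "v \<in> carrier_vec n" "v \<bullet> v = 1" "A *\<^sub>v v = e \<cdot>\<^sub>v v"
proof -
  obtain e w where w: "w \<in> carrier_vec n" "w \<noteq> 0\<^sub>v n" "A *\<^sub>v w = e \<cdot>\<^sub>v w"
    using symmetric_real_eigenvalue[OF assms] A unfolding eigenvalue_def eigenvector_def by auto
  have "w \<bullet> w > 0" using conjugate_square_greater_0_vec[of w n] w by simp
  define c where "c = 1 / sqrt (w \<bullet> w)"
  show ?thesis
  proof
    show "c \<cdot>\<^sub>v w \<in> carrier_vec n" using w by simp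
    show "(c \<cdot>\<^sub>v w) \<bullet> (c \<cdot>\<^sub>v w) = 1"
      using w \<open>w \<bullet> w > 0\<close> by (simp add: c_def)
    show "A *\<^sub>v (c \<cdot>\<^sub>v w) = e \<cdot>\<^sub>v (c \<cdot>\<^sub>v w)"
      using w A by (simp add: mult_mat_vec smult_smult_assoc mult.commute)
  qed
qed

section \<open>Spectral theorem\<close>

text \<open>Deflation: a Householder reflection turns an eigenvector into the first basis vector,
  which splits off a 1 by 1 block, and the induction hypothesis handles the remaining symmetric
  block. The predicate \<open>similar_mat_wit\<close> also records that \<open>P\<close> and its
  transpose are mutually inverse, so \<open>P\<close> is orthogonal.\<close>

theorem symmetric_diagonalization:
  fixes A :: "real mat"
  assumes "A \<in> carrier_mat n n" and "transpose_mat A = A"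
  shows "\<exists>P D. diagonal_mat D \<and> similar_mat_wit A D P (transpose_mat P)"
  using assms
proof (induction n arbitrary: A)
  case 0
  then show ?case
    by (intro exI[of _ "1\<^sub>m 0"] exI[of _ A]) (auto simp: similar_mat_wit_def diagonal_mat_def)
next
  case (Suc m)
  note A = Suc.prems(1) and sym = Suc.prems(2)
  obtain v e where v: "v \<in> carrier_vec (Suc m)" "v \<bullet> v = 1" "A *\<^sub>v v = e \<cdot>\<^sub>v v"
    using symmetric_unit_eigenvector[OF A sym] by auto
  let ?u = "unit_vec (Suc m) 0 :: real vec"
  define W where "W = householder (v - ?u)"
  have W: "W \<in> carrier_mat (Suc m) (Suc m)" using v by (simp add: W_def)
  have WT: "transpose_mat W = W" by (simp add: W_def)
  have WW: "W * W = 1\<^sub>m (Suc m)" using v by (simp add: W_def householder_involution)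
  have Wu: "W *\<^sub>v ?u = v" using v by (simp add: W_def householder_unit_vec)
  have Wv: "W *\<^sub>v v = ?u"
    unfolding Wu[symmetric] using W by (subst assoc_mult_mat_vec[symmetric]) (auto simp: WW)
  define B where "B = W * A * W"
  have B: "B \<in> carrier_mat (Suc m) (Suc m)" using W A by (simp add: B_def)
  have symB: "transpose_mat B = B"
    using W A by (simp add: B_def transpose_mult[of _ "Suc m" "Suc m" _ "Suc m"] WT sym assoc_mult_mat[of _ "Suc m" "Suc m" _ "Suc m" _ "Suc m"])
  have simAB: "similar_mat_wit A B W W"
  proof (rule similar_mat_witI[OF WW WW _ A B W W])
    have "W * B * W = (W * W) * A * (W * W)"
      using W A unfolding B_def by (simp add: assoc_mult_mat[of _ "Suc m" "Suc m" _ "Suc m" _ "Suc m"])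
    then show "A = W * B * W" using A by (simp add: WW)
  qed
  \<comment> \<open>\<open>W\<close> exchanges \<open>v\<close> and \<open>?u\<close>, so
    \<open>?u\<close> is an eigenvector of \<open>B\<close>. Hence the first column of
    \<open>B\<close>, and by symmetry its first row, vanishes off the corner.\<close>
  have "B *\<^sub>v ?u = W *\<^sub>v (A *\<^sub>v (W *\<^sub>v ?u))"
    using W A unfolding B_def by (simp add: assoc_mult_mat_vec[of _ "Suc m" "Suc m" _ "Suc m"])
  also have "\<dots> = e \<cdot>\<^sub>v ?u" using W v by (simp add: Wu Wv mult_mat_vec)
  finally have Bu: "B *\<^sub>v ?u = e \<cdot>\<^sub>v ?u" .
  have B0: "B $$ (i, 0) = (if i = 0 then e else 0)" if "i < Suc m" for i
    using arg_cong[OF Bu, of "\<lambda>x. x $ i"] that B by (simp add: scalar_prod_right_unit)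
  have B0': "B $$ (0, i) = (if i = 0 then e else 0)" if "i < Suc m" for i
  proof -
    have "B $$ (0, i) = transpose_mat B $$ (i, 0)" using B that by simp
    then show ?thesis using B0[OF that] by (simp add: symB)
  qed
  define A1 where "A1 = mat 1 1 (\<lambda>_. e)"
  define A3 where "A3 = mat m m (\<lambda>(i, j). B $$ (Suc i, Suc j))"
  have A1: "A1 \<in> carrier_mat 1 1" and A3: "A3 \<in> carrier_mat m m" by (auto simp: A1_def A3_def)
  have Bblock: "B = four_block_mat A1 (0\<^sub>m 1 m) (0\<^sub>m m 1) A3"
    using B by (intro eq_matI) (auto simp: A1_def A3_def B0 B0')
  have symA3: "transpose_mat A3 = A3"
  proof (rule eq_matI)
    fix i j assume ij: "i < dim_row A3" "j < dim_col A3"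
    have "B $$ (Suc j, Suc i) = transpose_mat B $$ (Suc i, Suc j)"
      using B ij by (simp add: A3_def del: index_transpose_mat)
         (simp add: A3_def)
    then show "transpose_mat A3 $$ (i, j) = A3 $$ (i, j)" using ij by (simp add: symB A3_def)
  qed (auto simp: A3_def)
  obtain P' D' where D': "diagonal_mat D'" and simA3: "similar_mat_wit A3 D' P' (transpose_mat P')"
    using Suc.IH[OF A3 symA3] by blast
  note c = similar_mat_witD2[OF A3 simA3]
  define P where "P = four_block_mat (1\<^sub>m 1) (0\<^sub>m 1 m) (0\<^sub>m m 1) P'"
  define D where "D = four_block_mat A1 (0\<^sub>m 1 m) (0\<^sub>m m 1) D'"
  have PT: "transpose_mat P = four_block_mat (1\<^sub>m 1) (0\<^sub>m 1 m) (0\<^sub>m m 1) (transpose_mat P')"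
    unfolding P_def using c by (subst transpose_four_block_mat) auto
  have "similar_mat_wit B D P (transpose_mat P)"
    unfolding Bblock D_def PT unfolding P_def
    by (rule similar_mat_wit_four_block[OF similar_mat_wit_refl[OF A1] simA3 _ _ A1 A3])
      (use c in auto)
  from similar_mat_wit_trans[OF simAB this]
  have "similar_mat_wit A D (W * P) (transpose_mat P * W)" .
  \<comment> \<open>\<open>W\<close> is its own transpose, so the composed witnesses are again a
    matrix and its transpose.\<close>
  moreover have "transpose_mat P * W = transpose_mat (W * P)"
  proof -
    have "P \<in> carrier_mat (Suc m) (Suc m)" using c by (auto simp: P_def)
    then show ?thesis using W by (simp add: transpose_mult[of _ "Suc m" "Suc m" _ "Suc m"] WT)
  qed
  moreover have "diagonal_mat D"
    using D' c unfolding D_def diagonal_mat_def by (auto simp: A1_def)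
  ultimately show ?case by metis
qed

section \<open>Bilinear forms and traces of square roots\<close>

text \<open>Vectors and matrices become plain functions, of which only the values at indices below
  \<open>n\<close> matter; the estimates are then manipulations of finite sums.\<close>

definition bform :: "nat \<Rightarrow> (nat \<Rightarrow> nat \<Rightarrow> real) \<Rightarrow> (nat \<Rightarrow> real) \<Rightarrow> (nat \<Rightarrow> real) \<Rightarrow> real" where
  "bform n A x y = (\<Sum>k<n. \<Sum>l<n. A k l * x k * y l)"

text \<open>\<open>u i k\<close> is coordinate \<open>k\<close> of vector \<open>i\<close>. The
  first clause is orthonormality; the second is the completeness relation, which yields expansions
  and Parseval's identity.\<close>

definition orthonormal_basis :: "nat \<Rightarrow> (nat \<Rightarrow> nat \<Rightarrow> real) \<Rightarrow> bool" where
  "orthonormal_basis n u \<longleftrightarrow>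
     (\<forall>i<n. \<forall>j<n. (\<Sum>k<n. u i k * u j k) = of_bool (i = j)) \<and>
     (\<forall>k<n. \<forall>l<n. (\<Sum>i<n. u i k * u i l) = of_bool (k = l))"

lemma bform_cong:
  assumes "\<And>k. k < n \<Longrightarrow> x k = x' k" "\<And>k. k < n \<Longrightarrow> y k = y' k"
  shows "bform n A x y = bform n A x' y'"
  using assms by (simp add: bform_def)

lemma bform_sum_left: "bform n A (\<lambda>k. \<Sum>i\<in>I. c i * x i k) y = (\<Sum>i\<in>I. c i * bform n A (x i) y)"
proof -
  have "bform n A (\<lambda>k. \<Sum>i\<in>I. c i * x i k) y
      = (\<Sum>k<n. \<Sum>l<n. \<Sum>i\<in>I. c i * (A k l * x i k * y l))"
    by (simp add: bform_def sum_distrib_left sum_distrib_right mult_ac)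
  also have "\<dots> = (\<Sum>k<n. \<Sum>i\<in>I. \<Sum>l<n. c i * (A k l * x i k * y l))"
    by (intro sum.cong refl sum.swap)
  also have "\<dots> = (\<Sum>i\<in>I. \<Sum>k<n. \<Sum>l<n. c i * (A k l * x i k * y l))"
    by (rule sum.swap)
  finally show ?thesis by (simp add: bform_def sum_distrib_left)
qed

lemma bform_transpose: "bform n A x y = bform n (\<lambda>k l. A l k) y x"
  unfolding bform_def by (subst sum.swap) (simp add: mult_ac)

lemma bform_sum_right: "bform n A x (\<lambda>k. \<Sum>i\<in>I. c i * y i k) = (\<Sum>i\<in>I. c i * bform n A x (y i))"
  by (simp add: bform_transpose[of n A] bform_sum_left)

lemma bform_scale: "bform n A (\<lambda>k. x k / c) (\<lambda>k. y k / d) = bform n A x y / (c * d)"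
  by (simp add: bform_def sum_divide_distrib)

lemma bform_sym:
  assumes "\<And>k l. k < n \<Longrightarrow> l < n \<Longrightarrow> A k l = A l k"
  shows "bform n A x y = bform n A y x"
  unfolding bform_transpose[of n A x y] using assms by (simp add: bform_def)

lemma bform_add: "bform n (\<lambda>k l. A k l + B k l) x y = bform n A x y + bform n B x y"
  by (simp add: bform_def sum.distrib algebra_simps)

section \<open>Cauchy-Schwarz for semidefinite forms and the trace estimate\<close>

lemma discriminant_nonpos:
  fixes a b c :: real
  assumes "\<And>t. 0 \<le> a * t\<^sup>2 - 2 * t * b + c" "0 \<le> a"
  shows "b\<^sup>2 \<le> a * c"
proof (cases "a = 0")
  case True
  have "b = 0"
  proof (rule ccontr)
    assume "b \<noteq> 0"
    \<comment> \<open>At this \<open>t\<close> the expression, linear because \<open>a = 0\<close>,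
      takes the value -1.\<close>
    then show False using assms(1)[of "(c + 1) / (2 * b)"] True by simp
  qed
  then show ?thesis using True by simp
next
  case False
  \<comment> \<open>The point \<open>b / a\<close> is the minimizer of the quadratic.\<close>
  then have "0 \<le> c - b\<^sup>2 / a" using assms(1)[of "b / a"] by (simp add: power2_eq_square)
  then show ?thesis using False assms(2) by (simp add: field_simps)
qed

text \<open>The form at t x - y is a nonnegative quadratic in t, so its discriminant is not
  positive. Semidefiniteness suffices because the discriminant bound covers a vanishing leading
  coefficient.\<close>

lemma bform_Cauchy_Schwarz:
  assumes sym: "\<And>k l. k < n \<Longrightarrow> l < n \<Longrightarrow> A k l = A l k"
    and psd: "\<And>x. 0 \<le> bform n A x x"
  shows "bform n A x y \<le> sqrt (bform n A x x) * sqrt (bform n A y y)"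
proof -
  have "0 \<le> bform n A x x * t\<^sup>2 - 2 * t * bform n A x y + bform n A y y" for t
  proof -
    have "bform n A (\<lambda>k. t * x k - y k) (\<lambda>k. t * x k - y k)
        = bform n A x x * t\<^sup>2 - t * bform n A x y - t * bform n A y x + bform n A y y"
      by (simp add: bform_def algebra_simps sum.distrib sum_subtractf sum_distrib_left power2_eq_square)
    then show ?thesis using psd[of "\<lambda>k. t * x k - y k"] bform_sym[OF sym, where x = x and y = y] by simp
  qed
  then have "(bform n A x y)\<^sup>2 \<le> bform n A x x * bform n A y y"
    using psd by (intro discriminant_nonpos) auto
  then show ?thesis by (simp add: real_le_rsqrt flip: real_sqrt_mult)
qed

text \<open>Division by zero is harmless here: if \<open>lam i = 0\<close>, then \<open>u i k / sqrt (lam i) = 0\<close>.\<close>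

lemma trace_bound:
  assumes sym: "\<And>k l. k < n \<Longrightarrow> l < n \<Longrightarrow> A k l = A l k"
    and psd: "\<And>x. 0 \<le> bform n A x x"
    and le: "\<And>x. bform n A x x \<le> bform n B x x"
    and u: "orthonormal_basis n u" and v: "orthonormal_basis n v"
    and diag: "\<And>i j. i < n \<Longrightarrow> j < n \<Longrightarrow> bform n B (u i) (u j) = (if i = j then lam i else 0)"
  shows "(\<Sum>i<n. bform n A (\<lambda>k. u i k / sqrt (lam i)) (u i)) \<le> (\<Sum>j<n. sqrt (bform n A (v j) (v j)))"
proof -
  define z where "z i = (\<lambda>k. u i k / sqrt (lam i))" for i
  define c where "c i j = (\<Sum>k<n. u i k * v j k)" for i j
  \<comment> \<open>This is the image of \<open>v j\<close> under the linear map sending each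
    \<open>u i\<close> to \<open>z i\<close>, a pseudo-inverse square root of \<open>B\<close>.
    Exchanging sums will pair \<open>w j\<close> with \<open>v j\<close>.\<close>
  define w where "w j = (\<lambda>k. \<Sum>i<n. c i j * z i k)" for j
  have lam: "lam i \<ge> 0" if "i < n" for i
    using diag[OF that that] le[of "u i"] psd[of "u i"] by simp
  have expand: "u i k = (\<Sum>j<n. c i j * v j k)" if "k < n" for i k
  proof -
    have "(\<Sum>j<n. c i j * v j k) = (\<Sum>j<n. \<Sum>l<n. u i l * (v j l * v j k))"
      by (simp add: c_def sum_distrib_right mult.assoc)
    also have "\<dots> = (\<Sum>l<n. u i l * (\<Sum>j<n. v j l * v j k))"
      by (subst sum.swap) (simp add: sum_distrib_left)
    also have "\<dots> = (\<Sum>l<n. u i l * of_bool (l = k))"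
      using v that by (intro sum.cong) (auto simp: orthonormal_basis_def)
    also have "\<dots> = u i k" using that by (simp add: of_bool_def if_distrib sum.delta' cong: if_cong)
    finally show ?thesis ..
  qed
  have parseval: "(\<Sum>i<n. (c i j)\<^sup>2) = 1" if "j < n" for j
  proof -
    have "(\<Sum>i<n. (c i j)\<^sup>2) = (\<Sum>i<n. \<Sum>k<n. \<Sum>l<n. v j k * v j l * (u i k * u i l))"
      by (simp add: c_def power2_eq_square sum_product mult_ac)
    also have "\<dots> = (\<Sum>k<n. \<Sum>i<n. \<Sum>l<n. v j k * v j l * (u i k * u i l))"
      by (rule sum.swap)
    also have "\<dots> = (\<Sum>k<n. \<Sum>l<n. \<Sum>i<n. v j k * v j l * (u i k * u i l))"
      by (intro sum.cong refl sum.swap)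
    also have "\<dots> = (\<Sum>k<n. \<Sum>l<n. v j k * v j l * (\<Sum>i<n. u i k * u i l))"
      by (simp add: sum_distrib_left)
    also have "\<dots> = (\<Sum>k<n. \<Sum>l<n. v j k * v j l * of_bool (k = l))"
      using u by (intro sum.cong) (auto simp: orthonormal_basis_def)
    also have "\<dots> = (\<Sum>k<n. v j k * v j k)"
      by (intro sum.cong) (simp_all add: of_bool_def if_distrib sum.delta cong: if_cong)
    also have "\<dots> = 1" using v that by (simp add: orthonormal_basis_def)
    finally show ?thesis .
  qed
  have w: "bform n B (w j) (w j) \<le> 1" if "j < n" for j
  proof -
    have "bform n B (w j) (w j) = (\<Sum>i<n. \<Sum>i'<n. c i j * (c i' j * bform n B (z i) (z i')))"
      by (simp add: w_def bform_sum_left bform_sum_right sum_distrib_left)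
    also have "\<dots> = (\<Sum>i<n. \<Sum>i'<n. if i' = i then (c i j)\<^sup>2 * (lam i / (sqrt (lam i) * sqrt (lam i))) else 0)"
      unfolding z_def bform_scale using diag
      by (intro sum.cong refl) (auto simp: power2_eq_square)
    also have "\<dots> = (\<Sum>i<n. (c i j)\<^sup>2 * (lam i / (sqrt (lam i) * sqrt (lam i))))"
      by simp
    \<comment> \<open>The quotient is 1 if \<open>lam i\<close> is positive and 0 if
      \<open>lam i = 0\<close>, hence an inequality only.\<close>
    also have "\<dots> \<le> (\<Sum>i<n. (c i j)\<^sup>2)"
      using lam by (intro sum_mono mult_left_le) auto
    finally show ?thesis using parseval[OF that] by simp
  qed
  have "(\<Sum>i<n. bform n A (z i) (u i)) = (\<Sum>i<n. \<Sum>j<n. c i j * bform n A (z i) (v j))"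
  proof (rule sum.cong)
    fix i
    have "bform n A (z i) (u i) = bform n A (z i) (\<lambda>k. \<Sum>j<n. c i j * v j k)"
      by (rule bform_cong) (simp_all add: expand)
    then show "bform n A (z i) (u i) = (\<Sum>j<n. c i j * bform n A (z i) (v j))"
      by (simp add: bform_sum_right)
  qed simp
  also have "\<dots> = (\<Sum>j<n. bform n A (w j) (v j))"
    by (subst sum.swap) (simp add: w_def bform_sum_left)
  also have "\<dots> \<le> (\<Sum>j<n. sqrt (bform n A (v j) (v j)))"
  proof (rule sum_mono)
    fix j assume "j \<in> {..<n}"
    \<comment> \<open>Domination by \<open>B\<close> bounds the first factor in the Cauchy-Schwarz
      inequality by 1, so that only the factor of \<open>v j\<close> survives.\<close>
    then have "bform n A (w j) (w j) \<le> 1" using w[of j] le[of "w j"] by simp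
    then have "sqrt (bform n A (w j) (w j)) * sqrt (bform n A (v j) (v j)) \<le> sqrt (bform n A (v j) (v j))"
      using psd by (intro mult_left_le_one_le) auto
    then show "bform n A (w j) (v j) \<le> sqrt (bform n A (v j) (v j))"
      using bform_Cauchy_Schwarz[OF sym psd, where x = "w j" and y = "v j"] by linarith
  qed
  finally show ?thesis by (simp add: z_def)
qed

section \<open>Square roots of eigenvalues of a sum of two forms\<close>

lemma sum_of_bool_mult:
  fixes f :: "nat \<Rightarrow> real"
  assumes "j < n"
  shows "(\<Sum>k<n. f k * of_bool (j = k)) = f j" "(\<Sum>k<n. f k * of_bool (k = j)) = f j"
proof -
  have "(\<Sum>k<n. f k * of_bool (j = k)) = (\<Sum>k<n. if k = j then f j else 0)"
    by (rule sum.cong) auto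
  moreover have "(\<Sum>k<n. f k * of_bool (k = j)) = (\<Sum>k<n. if k = j then f j else 0)"
    by (rule sum.cong) auto
  ultimately show "(\<Sum>k<n. f k * of_bool (j = k)) = f j" "(\<Sum>k<n. f k * of_bool (k = j)) = f j"
    using assms by simp_all
qed

lemma orthonormal_basis_standard: "orthonormal_basis n (\<lambda>i k. of_bool (i = k))"
  by (simp add: orthonormal_basis_def sum_of_bool_mult)

lemma bform_standard: "j < n \<Longrightarrow> bform n A (\<lambda>k. of_bool (j = k)) (\<lambda>k. of_bool (j = k)) = A j j"
  by (simp add: bform_def sum_of_bool_mult del: sum_mult_of_bool_eq sum_of_bool_mult_eq)

text \<open>Writing \<open>sqrt (lam i)\<close> as \<open>lam i / sqrt (lam i)\<close> makes the
  left side additive in the form. The trace estimate then applies to \<open>A\<close> with the basis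
  \<open>v\<close> and to \<open>P\<close> with the standard basis, where the values of
  \<open>P\<close> are its diagonal entries.\<close>

lemma sum_sqrt_eigenvalues_le:
  assumes symA: "\<And>k l. k < n \<Longrightarrow> l < n \<Longrightarrow> A k l = A l k"
    and psdA: "\<And>x. 0 \<le> bform n A x x"
    and symP: "\<And>k l. k < n \<Longrightarrow> l < n \<Longrightarrow> P k l = P l k"
    and psdP: "\<And>x. 0 \<le> bform n P x x"
    and u: "orthonormal_basis n u" and v: "orthonormal_basis n v"
    and diag: "\<And>i j. i < n \<Longrightarrow> j < n \<Longrightarrow>
      bform n (\<lambda>k l. A k l + P k l) (u i) (u j) = (if i = j then lam i else 0)"
  shows "(\<Sum>i<n. sqrt (lam i)) \<le> (\<Sum>j<n. sqrt (bform n A (v j) (v j))) + (\<Sum>k<n. sqrt (P k k))"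
proof -
  let ?z = "\<lambda>i k. u i k / sqrt (lam i)"
  have nonneg: "0 \<le> lam i" if "i < n" for i
    using diag[OF that that] psdA[of "u i"] psdP[of "u i"] by (simp add: bform_add)
  have "(\<Sum>i<n. sqrt (lam i)) = (\<Sum>i<n. bform n (\<lambda>k l. A k l + P k l) (?z i) (u i))"
  proof (rule sum.cong)
    fix i assume "i \<in> {..<n}"
    then have "bform n (\<lambda>k l. A k l + P k l) (?z i) (u i) = lam i / sqrt (lam i)"
      using bform_scale[of n _ "u i" "sqrt (lam i)" "u i" 1] diag[of i i] by simp
    then show "sqrt (lam i) = bform n (\<lambda>k l. A k l + P k l) (?z i) (u i)"
      using nonneg \<open>i \<in> {..<n}\<close> by (simp add: real_div_sqrt)
  qed simp
  also have "\<dots> = (\<Sum>i<n. bform n A (?z i) (u i)) + (\<Sum>i<n. bform n P (?z i) (u i))"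
    by (simp add: bform_add sum.distrib)
  also have "(\<Sum>i<n. bform n A (?z i) (u i)) \<le> (\<Sum>j<n. sqrt (bform n A (v j) (v j)))"
    by (rule trace_bound[OF symA psdA _ u v diag]) (use psdP in \<open>auto simp: bform_add\<close>)
  also have "(\<Sum>i<n. bform n P (?z i) (u i)) \<le> (\<Sum>k<n. sqrt (P k k))"
    using trace_bound[OF symP psdP _ u orthonormal_basis_standard diag] psdA
    by (auto simp: bform_add bform_standard)
  finally show ?thesis by simp
qed

section \<open>Laplacians\<close>

text \<open>Arbitrary weights are allowed so that the difference of two graph Laplacians is again an
  instance, with the difference of the adjacencies as weight.\<close>

definition weighted_laplacian :: "nat \<Rightarrow> (nat \<Rightarrow> nat \<Rightarrow> real) \<Rightarrow> nat \<Rightarrow> nat \<Rightarrow> real" where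
  "weighted_laplacian n w k l = (if k = l then \<Sum>m<n. w k m else 0) - w k l"

lemma weighted_laplacian_row_sum: "k < n \<Longrightarrow> (\<Sum>l<n. weighted_laplacian n w k l) = 0"
  by (simp add: weighted_laplacian_def sum_subtractf)

lemma weighted_laplacian_sym:
  "(\<And>k l. k < n \<Longrightarrow> l < n \<Longrightarrow> w k l = w l k) \<Longrightarrow> k < n \<Longrightarrow> l < n \<Longrightarrow>
   weighted_laplacian n w k l = weighted_laplacian n w l k"
  by (simp add: weighted_laplacian_def)

lemma weighted_laplacian_add:
  "weighted_laplacian n (\<lambda>k l. v k l + w k l) k l = weighted_laplacian n v k l + weighted_laplacian n w k l"
  by (simp add: weighted_laplacian_def sum.distrib)

text \<open>Twice the form equals the sum of w_kl (x_k - x_l)^2 over all ordered pairs.\<close>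

lemma bform_weighted_laplacian_nonneg:
  assumes sym: "\<And>k l. k < n \<Longrightarrow> l < n \<Longrightarrow> w k l = w l k"
    and nonneg: "\<And>k l. k < n \<Longrightarrow> l < n \<Longrightarrow> 0 \<le> w k l"
  shows "0 \<le> bform n (weighted_laplacian n w) x x"
proof -
  have diag: "(\<Sum>k<n. \<Sum>l<n. (if k = l then \<Sum>m<n. w k m else 0) * x k * x l)
      = (\<Sum>k<n. \<Sum>l<n. w k l * (x k)\<^sup>2)"
  proof (rule sum.cong)
    fix k assume k: "k \<in> {..<n}"
    have "(\<Sum>l<n. (if k = l then \<Sum>m<n. w k m else 0) * x k * x l)
        = (\<Sum>l<n. if l = k then (\<Sum>m<n. w k m) * (x k)\<^sup>2 else 0)"
      by (rule sum.cong) (auto simp: power2_eq_square)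
    then show "(\<Sum>l<n. (if k = l then \<Sum>m<n. w k m else 0) * x k * x l) = (\<Sum>l<n. w k l * (x k)\<^sup>2)"
      using k by (simp add: sum_distrib_right)
  qed simp
  have diag': "(\<Sum>k<n. \<Sum>l<n. w k l * (x k)\<^sup>2) = (\<Sum>k<n. \<Sum>l<n. w k l * (x l)\<^sup>2)"
    by (subst sum.swap) (intro sum.cong refl, simp add: sym)
  have "2 * bform n (weighted_laplacian n w) x x
      = 2 * (\<Sum>k<n. \<Sum>l<n. w k l * (x k)\<^sup>2) - 2 * (\<Sum>k<n. \<Sum>l<n. w k l * x k * x l)"
    by (simp add: bform_def weighted_laplacian_def left_diff_distrib sum_subtractf flip: diag)
  also have "\<dots> = (\<Sum>k<n. \<Sum>l<n. w k l * (x k)\<^sup>2) + (\<Sum>k<n. \<Sum>l<n. w k l * (x l)\<^sup>2)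
      - 2 * (\<Sum>k<n. \<Sum>l<n. w k l * x k * x l)"
    using diag' by simp
  also have "\<dots> = (\<Sum>k<n. \<Sum>l<n. w k l * (x k - x l)\<^sup>2)"
    by (simp add: sum_distrib_left power2_diff algebra_simps flip: sum.distrib sum_subtractf)
  also have "\<dots> \<ge> 0" using nonneg by (intro sum_nonneg) auto
  finally show ?thesis by simp
qed

section \<open>The Laplacian matrix of a graph\<close>

definition adj :: "'a pair_pre_digraph \<Rightarrow> nat \<Rightarrow> nat \<Rightarrow> real" where
  "adj G k l = of_bool ((vertex_list G ! k, vertex_list G ! l) \<in> parcs G)"

lemma adj_nonneg: "0 \<le> adj G k l" by (simp add: adj_def)

context
  fixes G :: "'a pair_pre_digraph"
  assumes G: "pair_graph G"
begin

lemma vertex_list_props: "distinct (vertex_list G)" "set (vertex_list G) = pverts G"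
proof -
  interpret pair_graph G by (rule G)
  have "\<exists>vs. distinct vs \<and> set vs = pverts G"
    using finite_distinct_list[OF pair_finite_verts] by blast
  then show "distinct (vertex_list G)" "set (vertex_list G) = pverts G"
    unfolding vertex_list_def by (metis (mono_tags, lifting) someI_ex)+
qed

lemma length_vertex_list: "length (vertex_list G) = card (pverts G)"
  using distinct_card[OF vertex_list_props(1)] vertex_list_props(2) by simp

lemma bij_vertex_list: "bij_betw (\<lambda>k. vertex_list G ! k) {..<card (pverts G)} (pverts G)"
  by (rule bij_betw_nth) (simp_all add: vertex_list_props length_vertex_list)

lemma adj_sym: "adj G k l = adj G l k"
proof -
  interpret pair_graph G by (rule G)
  show ?thesis using arcs_symmetric by (auto simp: adj_def)
qed

lemma out_degree_eq_card: "out_degree (with_proj G) v = card {u \<in> pverts G. (v, u) \<in> parcs G}"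
proof -
  interpret pair_graph G by (rule G)
  have "out_arcs (with_proj G) v = Pair v ` {u \<in> pverts G. (v, u) \<in> parcs G}"
    by (auto simp: out_arcs_def in_arcsD2)
  then show ?thesis unfolding out_degree_def by (simp add: card_image inj_on_def)
qed

lemma sum_adj:
  "(\<Sum>l<card (pverts G). adj G k l) = real (out_degree (with_proj G) (vertex_list G ! k))"
proof -
  interpret pair_graph G by (rule G)
  have "(\<Sum>l<card (pverts G). adj G k l) = (\<Sum>u\<in>pverts G. of_bool ((vertex_list G ! k, u) \<in> parcs G))"
    unfolding adj_def by (rule sum.reindex_bij_betw[OF bij_vertex_list])
  also have "\<dots> = real (out_degree (with_proj G) (vertex_list G ! k))"
    by (simp add: out_degree_eq_card of_bool_def sum.If_cases pair_finite_verts Int_def)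
  finally show ?thesis .
qed

lemma laplacian_mat_carrier: "laplacian_mat G \<in> carrier_mat (card (pverts G)) (card (pverts G))"
  unfolding laplacian_mat_def by (auto simp: degree_mat_def adjacency_mat_def length_vertex_list)

lemma laplacian_mat_index:
  assumes "k < card (pverts G)" "l < card (pverts G)"
  shows "laplacian_mat G $$ (k, l) = weighted_laplacian (card (pverts G)) (adj G) k l"
proof -
  have "laplacian_mat G $$ (k, l)
      = (if k = l then real (out_degree (with_proj G) (vertex_list G ! k)) else 0) - adj G k l"
    using assms length_vertex_list
    by (simp add: laplacian_mat_def degree_mat_def adjacency_mat_def adj_def)
  then show ?thesis unfolding weighted_laplacian_def sum_adj .
qed

text \<open>The all-ones vector lies in the kernel because the rows sum to 0, and it is nonzero when
  there is a vertex. This identifies the eigenvalue that \<open>LEL\<close> leaves out.\<close>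

lemma proots_laplacian_zero:
  assumes "0 < card (pverts G)"
  shows "0 \<in># proots (char_poly (laplacian_mat G))"
proof -
  let ?n = "card (pverts G)" and ?L = "laplacian_mat G"
  note L = laplacian_mat_carrier
  let ?e = "vec ?n (\<lambda>_. 1 :: real)"
  have "?L *\<^sub>v ?e = 0 \<cdot>\<^sub>v ?e"
  proof (rule eq_vecI)
    fix k assume "k < dim_vec (0 \<cdot>\<^sub>v ?e)"
    then have k: "k < ?n" by simp
    have "(?L *\<^sub>v ?e) $ k = (\<Sum>l<?n. ?L $$ (k, l))"
      using L k by (simp add: scalar_prod_def atLeast0LessThan)
    also have "\<dots> = 0" using k by (simp add: laplacian_mat_index weighted_laplacian_row_sum)
    finally show "(?L *\<^sub>v ?e) $ k = (0 \<cdot>\<^sub>v ?e) $ k" using k by simp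
  qed (use L in simp)
  moreover have "?e \<noteq> 0\<^sub>v ?n"
  proof
    assume "?e = 0\<^sub>v ?n"
    then have "?e $ 0 = 0\<^sub>v ?n $ 0" by (rule arg_cong)
    then show False using assms by simp
  qed
  ultimately have "eigenvalue ?L 0"
    using L unfolding eigenvalue_def eigenvector_def by (intro exI[of _ ?e]) auto
  moreover have "char_poly ?L \<noteq> 0" using degree_monic_char_poly[OF L] by auto
  ultimately show ?thesis by (simp add: eigenvalue_root_char_poly[OF L])
qed

end

section \<open>LEL as a sum over the whole spectrum\<close>

text \<open>The least entry is 0 and stands last in decreasing order, so omitting it changes
  nothing; the rest is invariance under permutation. For the empty list \<open>length es - 1\<close>
  is 0 and both sums are empty.\<close>

lemma sum_sqrt_drop_least:
  fixes es :: "real list"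
  assumes nonneg: "\<forall>x\<in>set es. 0 \<le> x" and zero: "es \<noteq> [] \<Longrightarrow> 0 \<in> set es"
  shows "(\<Sum>i<length es - 1. sqrt (rev (sort es) ! i)) = (\<Sum>i<length es. sqrt (es ! i))"
proof (cases "es = []")
  case False
  define ys where "ys = rev (sort es)"
  have len: "length ys = Suc (length es - 1)" using False by (simp add: ys_def)
  have "sort es \<noteq> []" using False by (metis length_sort length_0_conv)
  then obtain x xs where xs: "sort es = x # xs" by (cases "sort es") auto
  have "sorted (x # xs)" by (simp flip: xs)
  moreover have set: "set (x # xs) = set es" by (simp flip: xs)
  ultimately have "x \<le> 0" using zero[OF False] by auto
  moreover have "0 \<le> x" using nonneg set by auto
  ultimately have "x = 0" by simp
  moreover have "ys = rev xs @ [x]" by (simp add: ys_def xs)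
  ultimately have last: "ys ! (length es - 1) = 0" using len by (auto simp: nth_append)
  have "(\<Sum>i<length es. sqrt (es ! i)) = sum_list (map sqrt es)"
    by (simp add: sum_list_sum_nth atLeast0LessThan)
  also have "\<dots> = sum_mset (mset (map sqrt es))" by (rule sum_mset_sum_list[symmetric])
  also have "mset (map sqrt es) = mset (map sqrt ys)" by (simp add: ys_def)
  also have "sum_mset \<dots> = sum_list (map sqrt ys)" by (rule sum_mset_sum_list)
  also have "\<dots> = (\<Sum>i<length ys. sqrt (ys ! i))"
    by (simp add: sum_list_sum_nth atLeast0LessThan)
  finally show ?thesis unfolding len using last by (simp add: ys_def)
qed simp

lemma proots_prod_linear_factors:
  fixes es :: "'a :: idom list"
  shows "proots (\<Prod>a\<leftarrow>es. [:- a, 1:]) = mset es"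
proof (induction es)
  case (Cons a es)
  have "(\<Prod>a\<leftarrow>es. [:- a, 1:]) \<noteq> 0" by (auto simp: prod_list_zero_iff)
  then show ?case using Cons by (simp add: proots_mult del: mult_pCons_left)
qed simp

text \<open>Orthogonal diagonalization gives the eigenbasis, and similarity identifies the roots of
  the characteristic polynomial, with multiplicity, with the diagonal of \<open>D\<close>. The sum
  has one term more than \<open>LEL\<close>, namely a zero, and no order is imposed on
  \<open>lam\<close>.\<close>

lemma LEL_spectral:
  assumes G: "pair_graph G"
  obtains u lam where "orthonormal_basis (card (pverts G)) u"
    and "\<And>i j. i < card (pverts G) \<Longrightarrow> j < card (pverts G) \<Longrightarrow>
      bform (card (pverts G)) (weighted_laplacian (card (pverts G)) (adj G)) (u i) (u j)
        = (if i = j then lam i else 0)"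
    and "LEL G = (\<Sum>i<card (pverts G). sqrt (lam i))"
proof -
  define n where "n = card (pverts G)"
  define L where "L = laplacian_mat G"
  let ?W = "weighted_laplacian n (adj G)"
  have L: "L \<in> carrier_mat n n" using laplacian_mat_carrier[OF G] by (simp add: L_def n_def)
  have L_index: "L $$ (k, l) = ?W k l" if "k < n" "l < n" for k l
    using laplacian_mat_index[OF G] that by (simp add: L_def n_def)
  have "transpose_mat L = L"
    using L by (intro eq_matI) (auto simp: L_index weighted_laplacian_sym[OF adj_sym[OF G]])
  then obtain P D where D: "diagonal_mat D" and sim: "similar_mat_wit L D P (transpose_mat P)"
    using symmetric_diagonalization[OF L] by blast
  note c = similar_mat_witD2[OF L sim]
  \<comment> \<open>The eigenvectors are the columns of \<open>P\<close>, hence the exchanged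
    indices.\<close>
  define u where "u i k = P $$ (k, i)" for i k
  define lam where "lam i = D $$ (i, i)" for i
  have u: "orthonormal_basis n u"
    unfolding orthonormal_basis_def
  proof (intro conjI allI impI)
    fix i j assume ij: "i < n" "j < n"
    show "(\<Sum>k<n. u i k * u j k) = of_bool (i = j)"
    proof -
      have "(\<Sum>k<n. u i k * u j k) = (transpose_mat P * P) $$ (i, j)"
        using c(6) ij by (simp add: u_def scalar_prod_def atLeast0LessThan)
      then show ?thesis using ij by (simp add: c(2))
    qed
    show "(\<Sum>k<n. u k i * u k j) = of_bool (i = j)"
    proof -
      have "(\<Sum>k<n. u k i * u k j) = (P * transpose_mat P) $$ (i, j)"
        using c(6) ij by (simp add: u_def scalar_prod_def atLeast0LessThan)
      then show ?thesis using ij by (simp add: c(1))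
    qed
  qed
  have PLP: "transpose_mat P * L * P = D"
  proof -
    have "transpose_mat P * L * P = (transpose_mat P * P) * D * (transpose_mat P * P)"
      unfolding c(3) using c(4-) by (simp add: assoc_mult_mat[of _ n n _ n _ n])
    then show ?thesis using c by simp
  qed
  have diag: "bform n ?W (u i) (u j) = (if i = j then lam i else 0)" if ij: "i < n" "j < n" for i j
  proof -
    have "bform n ?W (u i) (u j) = (\<Sum>l<n. \<Sum>k<n. L $$ (k, l) * P $$ (k, i) * P $$ (l, j))"
      unfolding bform_def by (subst sum.swap) (simp add: L_index u_def)
    also have "\<dots> = (\<Sum>l<n. (transpose_mat P * L) $$ (i, l) * P $$ (l, j))"
      using ij c(6) L by (intro sum.cong refl)
        (simp add: scalar_prod_def atLeast0LessThan sum_distrib_left mult.commute)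
    also have "\<dots> = (transpose_mat P * L * P) $$ (i, j)"
      using ij c(6) L by (simp add: scalar_prod_def atLeast0LessThan del: assoc_mult_mat)
    also have "\<dots> = (if i = j then lam i else 0)"
      using D ij c unfolding PLP by (auto simp: lam_def diagonal_mat_def)
    finally show ?thesis .
  qed
  have lam_nonneg: "0 \<le> lam i" if "i < n" for i
    using bform_weighted_laplacian_nonneg[of n "adj G", OF adj_sym[OF G] adj_nonneg, of "u i"]
      diag[OF that that] by simp
  define es where "es = diag_mat D"
  have len: "length es = n" using c(5) by (auto simp: es_def diag_mat_def)
  have es: "es ! i = lam i" if "i < n" for i
    using c(5) that by (auto simp: es_def diag_mat_def lam_def)
  have "similar_mat L D" using sim by (auto simp: similar_mat_def)
  then have "char_poly L = char_poly D" by (rule char_poly_similar)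
  also have "\<dots> = (\<Prod>a\<leftarrow>es. [:- a, 1:])"
    unfolding es_def using D c(5)
    by (intro char_poly_upper_triangular[of _ n]) (auto simp: diagonal_mat_def upper_triangular_def)
  finally have roots: "proots (char_poly L) = mset es"
    by (simp add: proots_prod_linear_factors)
  have "LEL G = (\<Sum>i<length es - 1. sqrt (rev (sort es) ! i))"
    by (simp add: LEL_def laplacian_eigenvalues_def roots[unfolded L_def] len n_def)
  also have "\<dots> = (\<Sum>i<length es. sqrt (es ! i))"
  proof (rule sum_sqrt_drop_least)
    show "\<forall>x\<in>set es. 0 \<le> x" using lam_nonneg es len by (auto simp: in_set_conv_nth)
    assume "es \<noteq> []"
    then have "0 < card (pverts G)" using len unfolding n_def by (metis length_greater_0_conv)
    then show "0 \<in> set es"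
      using proots_laplacian_zero[OF G] roots by (simp add: L_def)
  qed
  also have "\<dots> = (\<Sum>i<n. sqrt (lam i))" using es len by simp
  finally show ?thesis using that[of u lam] u diag by (simp add: n_def)
qed

section \<open>Degree sums and edges\<close>

text \<open>An edge {x, y} can only arise from the arcs (x, y) and (y, x). With the degree sum this
  bounds the total degree by twice the number of edges.\<close>

lemma card_parcs_le:
  fixes G :: "'a pair_pre_digraph"
  assumes G: "pair_graph G"
  shows "card (parcs G) \<le> 2 * card (edge_set G)"
proof -
  interpret pair_graph G by (rule G)
  have edges: "edge_set G = (\<lambda>e. {fst e, snd e}) ` parcs G"
    by (force simp: edge_set_def)
  have fin: "finite (edge_set G)" by (simp add: edges pair_finite_arcs)
  let ?F = "\<lambda>e. {a :: 'a \<times> 'a. {fst a, snd a} = e}"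
  have fiber: "?F {x, y} = {(x, y), (y, x)}" for x y :: 'a
    by (auto simp: doubleton_eq_iff)
  have two: "finite (?F e) \<and> card (?F e) \<le> 2" if e: "e \<in> edge_set G" for e
  proof -
    obtain x y where "e = {x, y}" using e unfolding edge_set_def by blast
    then have "?F e = {(x, y), (y, x)}" by (simp only: fiber)
    moreover have "card {(x, y), (y, x)} \<le> 2" by (rule card_insert_le_m1) simp_all
    ultimately show ?thesis by (simp only: finite.intros simp_thms)
  qed
  have "parcs G \<subseteq> (\<Union>e\<in>edge_set G. ?F e)" by (auto simp: edges)
  then have "card (parcs G) \<le> card (\<Union>e\<in>edge_set G. ?F e)"
    using fin two by (intro card_mono finite_UN_I) simp_all
  also have "\<dots> \<le> (\<Sum>e\<in>edge_set G. card (?F e))"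
    by (rule card_UN_le[OF fin])
  also have "\<dots> \<le> (\<Sum>e\<in>edge_set G. 2)"
    using two by (intro sum_mono) simp
  finally show ?thesis by simp
qed

lemma sum_out_degree:
  assumes G: "pair_graph G"
  shows "(\<Sum>v\<in>pverts G. out_degree (with_proj G) v) = card (parcs G)"
proof -
  interpret pair_graph G by (rule G)
  have "parcs G = (SIGMA v:pverts G. {u \<in> pverts G. (v, u) \<in> parcs G})"
    by (auto simp: in_arcsD1 in_arcsD2)
  then have "card (parcs G) = card (SIGMA v:pverts G. {u \<in> pverts G. (v, u) \<in> parcs G})"
    by (rule arg_cong)
  also have "\<dots> = (\<Sum>v\<in>pverts G. card {u \<in> pverts G. (v, u) \<in> parcs G})"
    by (rule card_SigmaI) (simp_all add: pair_finite_verts)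
  finally show ?thesis by (simp add: out_degree_eq_card[OF G])
qed

section \<open>Effect of edge deletion on LEL\<close>

lemma LEL_spanning_subgraph:
  assumes G: "pair_graph G" and H: "pair_graph H" and span: "spanning (with_proj H) (with_proj G)"
  shows "LEL H \<le> LEL G"
    and "LEL G \<le> LEL H + sqrt (real (card (pverts G) - card {v \<in> pverts H.
        out_degree (with_proj H) v = out_degree (with_proj G) v}) * (2 * real (card (edge_set G))))"
proof -
  let ?dG = "out_degree (with_proj G)" and ?dH = "out_degree (with_proj H)"
  define n where "n = card (pverts G)"
  have verts: "pverts H = pverts G" and arcs: "parcs H \<subseteq> parcs G"
    using span by (auto simp: spanning_def subgraph_def)
  \<comment> \<open>The choice in \<open>vertex_list\<close> depends on the vertex set alone, so
    both Laplacians use the same coordinates and can be compared entrywise.\<close>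
  have vl: "vertex_list H = vertex_list G" by (simp add: vertex_list_def verts)
  define A where "A = weighted_laplacian n (adj H)"
  define P where "P = weighted_laplacian n (\<lambda>k l. adj G k l - adj H k l)"
  have le: "adj H k l \<le> adj G k l" for k l using arcs by (auto simp: adj_def vl)
  have symA: "A k l = A l k" if "k < n" "l < n" for k l
    using that unfolding A_def by (intro weighted_laplacian_sym) (simp_all add: adj_sym[OF H])
  have symP: "P k l = P l k" if "k < n" "l < n" for k l
    using that unfolding P_def by (intro weighted_laplacian_sym) (simp_all add: adj_sym[OF H] adj_sym[OF G])
  have psdA: "0 \<le> bform n A x x" for x
    unfolding A_def by (intro bform_weighted_laplacian_nonneg adj_nonneg adj_sym[OF H])
  have psdP: "0 \<le> bform n P x x" for x
    unfolding P_def using le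
    by (intro bform_weighted_laplacian_nonneg) (simp_all add: adj_sym[OF H] adj_sym[OF G])
  have sum: "weighted_laplacian n (adj G) = (\<lambda>k l. A k l + P k l)"
    by (simp add: fun_eq_iff A_def P_def flip: weighted_laplacian_add)
  obtain u lam where u: "orthonormal_basis n u"
    and du: "\<And>i j. i < n \<Longrightarrow> j < n \<Longrightarrow>
      bform n (\<lambda>k l. A k l + P k l) (u i) (u j) = (if i = j then lam i else 0)"
    and LG: "LEL G = (\<Sum>i<n. sqrt (lam i))"
    using LEL_spectral[OF G] unfolding n_def[symmetric] sum by blast
  obtain v mu where v: "orthonormal_basis n v"
    and dv: "\<And>i j. i < n \<Longrightarrow> j < n \<Longrightarrow> bform n A (v i) (v j) = (if i = j then mu i else 0)"
    and LH: "LEL H = (\<Sum>i<n. sqrt (mu i))"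
    using LEL_spectral[OF H] unfolding verts n_def[symmetric] A_def[symmetric] by blast
  \<comment> \<open>This is the comparison with second form 0, with the eigenbasis of
    \<open>H\<close> diagonalizing and that of \<open>G\<close> as the test basis.\<close>
  have "LEL H \<le> (\<Sum>j<n. sqrt (bform n A (u j) (u j)))"
    using sum_sqrt_eigenvalues_le[of n A "\<lambda>_ _. 0" v u mu] symA psdA v u dv
    by (simp add: LH bform_def)
  also have "\<dots> \<le> LEL G"
    unfolding LG
  proof (rule sum_mono)
    fix i assume "i \<in> {..<n}"
    then show "sqrt (bform n A (u i) (u i)) \<le> sqrt (lam i)"
      using du[of i i] psdP[of "u i"] by (simp add: bform_add)
  qed
  finally show "LEL H \<le> LEL G" .
  have fin: "finite (pverts G)"
  proof -
    interpret pair_graph G by (rule G)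
    show ?thesis by (rule pair_finite_verts)
  qed
  let ?B = "{v \<in> pverts G. ?dH v \<noteq> ?dG v}"
  have deg_le: "?dH v \<le> ?dG v" for v
    using fin arcs by (auto simp: out_degree_eq_card[OF H] out_degree_eq_card[OF G] verts intro!: card_mono)
  \<comment> \<open>Without loops the weight has zero diagonal, so the entry is the row sum of the
    weights, the loss of degree at the vertex.\<close>
  have Pkk: "P k k = real (?dG (vertex_list G ! k)) - real (?dH (vertex_list G ! k))" if "k < n" for k
  proof -
    have "adj G k k = 0" "adj H k k = 0"
    proof -
      interpret pair_graph G by (rule G)
      show "adj G k k = 0" "adj H k k = 0" using arcs no_loops' by (auto simp: adj_def vl)
    qed
    then show ?thesis
      using sum_adj[OF G, of k] sum_adj[OF H, of k]
      by (simp add: P_def weighted_laplacian_def sum_subtractf n_def verts vl)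
  qed
  have "LEL G \<le> (\<Sum>j<n. sqrt (bform n A (v j) (v j))) + (\<Sum>k<n. sqrt (P k k))"
    unfolding LG by (rule sum_sqrt_eigenvalues_le[OF symA psdA symP psdP u v du])
  also have "(\<Sum>j<n. sqrt (bform n A (v j) (v j))) = LEL H"
    by (simp add: LH dv)
  also have "(\<Sum>k<n. sqrt (P k k)) = (\<Sum>x\<in>pverts G. sqrt (real (?dG x) - real (?dH x)))"
    using sum.reindex_bij_betw[OF bij_vertex_list[OF G], of "\<lambda>x. sqrt (real (?dG x) - real (?dH x))"]
    by (simp add: Pkk n_def)
  \<comment> \<open>Vertices of unchanged degree contribute \<open>sqrt 0\<close>. The factor 1
    prepares the Cauchy-Schwarz inequality, which produces \<open>card ?B\<close>.\<close>
  also have "\<dots> = (\<Sum>x\<in>?B. 1 * sqrt (real (?dG x) - real (?dH x)))"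
    using fin by (intro sum.mono_neutral_cong_right) auto
  also have "\<dots> \<le> sqrt (real (card ?B) * (2 * real (card (edge_set G))))"
  proof (rule real_le_rsqrt)
    have "(\<Sum>x\<in>?B. 1 * sqrt (real (?dG x) - real (?dH x)))\<^sup>2
        \<le> (\<Sum>x\<in>?B. 1\<^sup>2) * (\<Sum>x\<in>?B. (sqrt (real (?dG x) - real (?dH x)))\<^sup>2)"
      by (rule Cauchy_Schwarz_ineq_sum)
    also have "\<dots> = real (card ?B) * (\<Sum>x\<in>?B. real (?dG x) - real (?dH x))"
      using deg_le by simp
    also have "\<dots> \<le> real (card ?B) * (\<Sum>x\<in>pverts G. real (?dG x))"
    proof (rule mult_left_mono)
      have "(\<Sum>x\<in>?B. real (?dG x) - real (?dH x)) \<le> (\<Sum>x\<in>?B. real (?dG x))"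
        by (intro sum_mono) simp
      also have "\<dots> \<le> (\<Sum>x\<in>pverts G. real (?dG x))"
        using fin by (intro sum_mono2) auto
      finally show "(\<Sum>x\<in>?B. real (?dG x) - real (?dH x)) \<le> (\<Sum>x\<in>pverts G. real (?dG x))" .
    qed simp
    also have "(\<Sum>x\<in>pverts G. real (?dG x)) = real (card (parcs G))"
      using sum_out_degree[OF G] by (simp flip: of_nat_sum)
    also have "real (card ?B) * \<dots> \<le> real (card ?B) * (2 * real (card (edge_set G)))"
      using card_parcs_le[OF G] by (intro mult_left_mono) linarith+
    finally show "(\<Sum>x\<in>?B. 1 * sqrt (real (?dG x) - real (?dH x)))\<^sup>2
        \<le> real (card ?B) * (2 * real (card (edge_set G)))" .
  qed
  also have "card ?B = card (pverts G) - card {v \<in> pverts H. ?dH v = ?dG v}"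
  proof -
    have "?B = pverts G - {v \<in> pverts H. ?dH v = ?dG v}" by (auto simp: verts)
    then show ?thesis using fin by (simp add: card_Diff_subset verts)
  qed
  finally show "LEL G \<le> LEL H + sqrt (real (card (pverts G) - card {v \<in> pverts H. ?dH v = ?dG v})
      * (2 * real (card (edge_set G))))" by simp
qed

section \<open>Passage to the limit\<close>

theorem theorem3p6:
  fixes G H :: "nat \<Rightarrow> 'a pair_pre_digraph" and h :: real
  assumes "\<And>n. pair_graph (G n)"
    and "bounded_average_degree G"
    and "filterlim (\<lambda>n. card (pverts (G n))) at_top sequentially"
    and "(\<lambda>n. LEL (G n) / real (card (pverts (G n)))) \<longlonglongrightarrow> h"
    and "h \<noteq> 0"
    and "\<And>n. pair_graph (H n)"
    and "\<And>n. spanning (with_proj (H n)) (with_proj (G n))"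
    and "(\<lambda>n. real (card {v \<in> pverts (H n).
             out_degree (with_proj (H n)) v = out_degree (with_proj (G n)) v})
           / real (card (pverts (G n)))) \<longlonglongrightarrow> 1"
  shows "(\<lambda>n. LEL (H n) / real (card (pverts (G n)))) \<longlonglongrightarrow> h"
proof -
  define N where "N n = real (card (pverts (G n)))" for n
  define good where "good n = card {v \<in> pverts (H n).
      out_degree (with_proj (H n)) v = out_degree (with_proj (G n)) v}" for n
  obtain C where C: "2 * real (card (edge_set (G n))) / N n \<le> C" for n
    using assms(2) unfolding bounded_average_degree_def bdd_above_def N_def by auto
  \<comment> \<open>This is the error term of the lower bound per vertex: the fraction of vertices
    whose degree changes, times the bound on the average degree. Its limit is 0.\<close>
  have lim: "(\<lambda>n. sqrt ((1 - real (good n) / N n) * C)) \<longlonglongrightarrow> sqrt ((1 - 1) * C)"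
    using assms(8) unfolding good_def N_def by (intro tendsto_intros)
  have lower: "LEL (G n) / N n - sqrt ((1 - real (good n) / N n) * C) \<le> LEL (H n) / N n"
    if n: "0 < N n" for n
  proof -
    interpret pair_graph "G n" by (rule assms(1))
    have "pverts (H n) = pverts (G n)" using assms(7)[of n] by (auto simp: spanning_def)
    then have good: "good n \<le> card (pverts (G n))"
      unfolding good_def using pair_finite_verts by (auto intro: card_mono)
    then have good': "real (good n) / N n \<le> 1"
      using n by (simp add: N_def del: card_gt_0_iff)
    let ?m = "real (card (pverts (G n)) - good n)" and ?e = "2 * real (card (edge_set (G n)))"
    have "LEL (G n) / N n \<le> (LEL (H n) + sqrt (?m * ?e)) / N n"
      using LEL_spanning_subgraph(2)[OF assms(1,6,7), of n] n
      unfolding good_def by (intro divide_right_mono) auto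
    \<comment> \<open>One factor \<open>1 / N n\<close> outside the root becomes two inside it, one
      for each factor of the product.\<close>
    also have "\<dots> = LEL (H n) / N n + sqrt ((?m / N n) * (?e / N n))"
      using n by (simp add: add_divide_distrib real_sqrt_divide real_sqrt_mult)
    also have "?m = N n - real (good n)" using good by (simp add: N_def of_nat_diff)
    also have "(N n - real (good n)) / N n = 1 - real (good n) / N n"
      using n by (simp add: diff_divide_distrib)
    also have "sqrt ((1 - real (good n) / N n) * (?e / N n)) \<le> sqrt ((1 - real (good n) / N n) * C)"
      using C[of n] good' by (intro real_sqrt_le_mono mult_left_mono) simp_all
    finally show ?thesis by simp
  qed
  \<comment> \<open>Empty graphs, for which the quotients are 0 by convention, occur for only
    finitely many \<open>n\<close>.\<close>
  have pos: "\<forall>\<^sub>F n in sequentially. 0 < N n"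
    using assms(3)[unfolded filterlim_at_top, rule_format, of 1]
    by (rule eventually_mono) (unfold N_def, linarith)
  have "(\<lambda>n. LEL (H n) / N n) \<longlonglongrightarrow> h"
  proof (rule tendsto_sandwich)
    show "(\<lambda>n. LEL (G n) / N n - sqrt ((1 - real (good n) / N n) * C)) \<longlonglongrightarrow> h"
      using tendsto_diff[OF assms(4) lim[unfolded N_def]] by (simp add: N_def)
    show "(\<lambda>n. LEL (G n) / N n) \<longlonglongrightarrow> h" using assms(4) by (simp add: N_def)
    show "\<forall>\<^sub>F n in sequentially. LEL (G n) / N n - sqrt ((1 - real (good n) / N n) * C) \<le> LEL (H n) / N n"
      using pos by eventually_elim (rule lower)
    show "\<forall>\<^sub>F n in sequentially. LEL (H n) / N n \<le> LEL (G n) / N n"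
      using LEL_spanning_subgraph(1)[OF assms(1,6,7)] by (simp add: N_def divide_right_mono)
  qed
  then show ?thesis by (simp add: N_def)
qed

end
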